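(* Let $\Gamma$ be a metrized graph with edges $e_1,\dots,e_e$ of lengths $L_1,\dots,L_e$, let $n\ge2$ be an integer, and let $\Gamma^{DA,n}$ be obtained from $\Gamma$ by replacing each edge $e_i$ by $n$ edges with the same end points, each of length $\frac{L_i}{n}$. Then $$\tau(\Gamma^{DA,n})=\frac{\tau(\Gamma)}{n^2}+\frac{\ell(\Gamma)}{12}\Big(\frac{n-1}{n}\Big)^2+\frac{n-1}{6n^2}\sum_{i=1}^{e}\frac{L_i^2}{L_i+R_i}.$$
   Context: A metrized graph is a finite connected graph (multiple edges and self-loops allowed) in which each edge is identified with a closed interval of positive length; $\ell(\Gamma)$ is the total length. Regard it as a resistive circuit with segment resistance equal to length; $r(x,y)$ is the effective resistance. For an edge $e_i$ with end points $p_i,q_i$, $R_i$ is the effective resistance between $p_i$ and $q_i$ in $\Gamma-e_i$ (the graph with the interior of $e_i$ removed); if $\Gamma-e_i$ is disconnected, $R_i=\infty$ and the term $\frac{L_i^2}{L_i+R_i}$ is $0$. The tau constant is $\tau(\Gamma)=\frac14\int_\Gamma\big(\frac{\partial}{\partial x}r(x,y)\big)^2dx$ (independent of $y$). *)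

theory Defs
  imports "HOL-Analysis.Analysis" "Graph_Theory.Graph_Theory"
begin

text \<open>
  A metrized graph is given by a finite connected multigraph \<open>G\<close> (parallel edges and loops
  allowed) and a length function \<open>L\<close> on its edges. The direction of an arc only fixes a
  coordinate: an arc \<open>e\<close> is identified with the interval \<open>[0, L e]\<close>, where \<open>0\<close> is glued to
  \<open>tail G e\<close> and \<open>L e\<close> to \<open>head G e\<close>. Below, \<open>connected\<close> has to be qualified because of the
  topological notion of the same name; it is connectedness of the underlying undirected graph
  and includes that there is at least one vertex.
\<close>

definition metrized_graph :: "('v, 'e) pre_digraph \<Rightarrow> 'e weight_fun \<Rightarrow> bool" where
  "metrized_graph G L \<longleftrightarrow>
     fin_digraph G \<and> Digraph_Component.connected G \<and> (\<forall>e\<in>arcs G. 0 < L e)"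

definition total_length :: "('v, 'e) pre_digraph \<Rightarrow> 'e weight_fun \<Rightarrow> real" where
  "total_length G L = (\<Sum>e\<in>arcs G. L e)"

text \<open>
  The electric circuit on \<open>G\<close> in which the edge \<open>e\<close> is a resistor of resistance \<open>L e\<close>. By Ohm's
  law the current leaving \<open>v\<close> through \<open>e\<close> is the potential drop along \<open>e\<close> divided by \<open>L e\<close>;
  Kirchhoff's current law says that the net current leaving \<open>v\<close> is the current injected at \<open>v\<close>.
  A unit current enters at \<open>p\<close> and exits at \<open>q\<close>. A loop is both an outgoing and an incoming arc
  and contributes zero.
\<close>

definition unit_current_potential ::
  "('v, 'e) pre_digraph \<Rightarrow> 'e weight_fun \<Rightarrow> 'v \<Rightarrow> 'v \<Rightarrow> ('v \<Rightarrow> real) \<Rightarrow> bool" where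
  "unit_current_potential G L p q f \<longleftrightarrow>
     (\<forall>v\<in>verts G.
        (\<Sum>e\<in>out_arcs G v. (f v - f (head G e)) / L e)
        + (\<Sum>e\<in>in_arcs G v. (f v - f (tail G e)) / L e)
      = (if v = p then 1 else 0) - (if v = q then 1 else 0))"

text \<open>
  On a connected circuit the potential exists and is unique up to an additive constant, so that
  the potential difference is well defined.
\<close>

definition vertex_resistance ::
  "('v, 'e) pre_digraph \<Rightarrow> 'e weight_fun \<Rightarrow> 'v \<Rightarrow> 'v \<Rightarrow> real" where
  "vertex_resistance G L p q =
     (THE r. \<exists>f. unit_current_potential G L p q f \<and> r = f p - f q)"

datatype ('v, 'e) point = Vertex 'v | Inner 'e real

definition points :: "('v, 'e) pre_digraph \<Rightarrow> 'e weight_fun \<Rightarrow> ('v, 'e) point set" where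
  "points G L = Vertex ` verts G \<union> {Inner e t | e t. e \<in> arcs G \<and> 0 < t \<and> t < L e}"

definition edge_point :: "('v, 'e) pre_digraph \<Rightarrow> 'e weight_fun \<Rightarrow> 'e \<Rightarrow> real \<Rightarrow> ('v, 'e) point" where
  "edge_point G L e t =
     (if t = 0 then Vertex (tail G e) else if t = L e then Vertex (head G e) else Inner e t)"

text \<open>
  The same metrized graph with the points of a finite set \<open>S \<subseteq> points G L\<close> added to the vertex
  set. The edge \<open>e\<close> is cut into the segments \<open>(e, a, b)\<close> between consecutive cut coordinates
  \<open>a < b\<close>; such a segment has length \<open>b - a\<close>.
\<close>

definition cuts :: "'e weight_fun \<Rightarrow> ('v, 'e) point set \<Rightarrow> 'e \<Rightarrow> real set" where
  "cuts L S e = {0, L e} \<union> {t. Inner e t \<in> S}"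

definition subdivide ::
  "('v, 'e) pre_digraph \<Rightarrow> 'e weight_fun \<Rightarrow> ('v, 'e) point set
     \<Rightarrow> (('v, 'e) point, 'e \<times> real \<times> real) pre_digraph" where
  "subdivide G L S =
     \<lparr> verts = Vertex ` verts G \<union> S,
       arcs = {(e, a, b). e \<in> arcs G \<and> a \<in> cuts L S e \<and> b \<in> cuts L S e \<and> a < b
                 \<and> {a<..<b} \<inter> cuts L S e = {}},
       tail = (\<lambda>(e, a, b). edge_point G L e a),
       head = (\<lambda>(e, a, b). edge_point G L e b) \<rparr>"

definition segment_length :: "('e \<times> real \<times> real) weight_fun" where
  "segment_length = (\<lambda>(e, a, b). b - a)"

definition resistance ::
  "('v, 'e) pre_digraph \<Rightarrow> 'e weight_fun \<Rightarrow> ('v, 'e) point \<Rightarrow> ('v, 'e) point \<Rightarrow> real" where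
  "resistance G L x y = vertex_resistance (subdivide G L {x, y}) segment_length x y"

text \<open>
  On each edge \<open>r(x, y)\<close> is differentiable in \<open>x\<close> except possibly at \<open>y\<close> and at the end points,
  where the value of \<^const>\<open>deriv\<close> is irrelevant for the integral.
\<close>

definition tau_at :: "('v, 'e) pre_digraph \<Rightarrow> 'e weight_fun \<Rightarrow> ('v, 'e) point \<Rightarrow> real" where
  "tau_at G L y =
     1 / 4 * (\<Sum>e\<in>arcs G.
       integral {0..L e} (\<lambda>t. (deriv (\<lambda>s. resistance G L (edge_point G L e s) y) t)\<^sup>2))"

text \<open>The tau constant is the common value of the integral for all base points \<open>y\<close>.\<close>

definition tau :: "('v, 'e) pre_digraph \<Rightarrow> 'e weight_fun \<Rightarrow> real" where
  "tau G L = (THE c. \<forall>y\<in>points G L. tau_at G L y = c)"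

definition complementary_resistance ::
  "('v, 'e) pre_digraph \<Rightarrow> 'e weight_fun \<Rightarrow> 'e \<Rightarrow> ereal" where
  "complementary_resistance G L e =
     (let G' = pre_digraph.del_arc G e in
      if Digraph_Component.connected G'
      then ereal (resistance G' L (Vertex (tail G e)) (Vertex (head G e)))
      else \<infinity>)"

definition multiply_edges :: "('v, 'e) pre_digraph \<Rightarrow> nat \<Rightarrow> ('v, 'e \<times> nat) pre_digraph" where
  "multiply_edges G n =
     \<lparr> verts = verts G, arcs = arcs G \<times> {..<n},
       tail = (\<lambda>(e, k). tail G e), head = (\<lambda>(e, k). head G e) \<rparr>"

definition multiply_edges_length :: "'e weight_fun \<Rightarrow> nat \<Rightarrow> ('e \<times> nat) weight_fun" where
  "multiply_edges_length L n = (\<lambda>(e, k). L e / real n)"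

end

theory Submission
  imports Defs
begin

section \<open>The tau constant of a graph with multiplied edges\<close>

text \<open>
  In weak form, \<open>f\<close> is the potential of a unit current from \<open>p\<close> to \<open>q\<close> iff its Dirichlet energy
  form satisfies \<open>E(f, g) = g p - g q\<close> for all \<open>g\<close>. Let \<open>j\<close> be the Green function grounded at a
  vertex \<open>z\<close>, extended to a kernel \<open>K\<close> on all points of the metrized graph. Then
  \<open>r(x, y) = K x x + K y y - 2 K x y\<close>. Since \<open>E(K y, g) = g y - g z\<close> for \<open>g x = K x x - K y x\<close>
  vanishes, \<open>\<integral> (r(x, y)')^2 dx = \<integral> ((K x x)')^2 dx\<close> for every \<open>y\<close>. On an edge of length \<open>L\<close> from
  \<open>p\<close> to \<open>q\<close> the function \<open>K x x\<close> is quadratic, and the integral is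
  \<open>(j q q - j p p)^2 / L + (L - r(p, q))^2 / (3 L)\<close>. Multiplying the edges by \<open>n\<close> keeps the
  vertices and divides \<open>j\<close> by \<open>n^2\<close>, and \<open>L^2 / (L + R) = L - r(p, q)\<close>; the theorem is then an
  identity of rational functions for each edge.
\<close>

subsection \<open>Energy, potentials and Green functions\<close>

text \<open>The Dirichlet form of the network. Reversing an arc changes the sign of both factors, so
  the orientation of the arcs does not matter, and loops contribute 0.\<close>

definition energy ::
  "('v, 'e) pre_digraph \<Rightarrow> 'e weight_fun \<Rightarrow> ('v \<Rightarrow> real) \<Rightarrow> ('v \<Rightarrow> real) \<Rightarrow> real" where
  "energy G L f g =
     (\<Sum>e\<in>arcs G. (f (head G e) - f (tail G e)) * (g (head G e) - g (tail G e)) / L e)"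

section \<open>Bilinearity and positivity of the energy form\<close>

lemma energy_commute: "energy G L f g = energy G L g f"
  by (simp add: energy_def mult.commute)

lemma energy_add_left: "energy G L (\<lambda>v. f v + g v) h = energy G L f h + energy G L g h"
  by (simp add: energy_def sum.distrib[symmetric] add_divide_distrib[symmetric] algebra_simps)

lemma energy_diff_left: "energy G L (\<lambda>v. f v - g v) h = energy G L f h - energy G L g h"
  by (simp add: energy_def sum_subtractf[symmetric] diff_divide_distrib[symmetric] algebra_simps)

lemma energy_scale_left: "energy G L (\<lambda>v. c * f v) h = c * energy G L f h"
  by (simp add: energy_def sum_distrib_left algebra_simps)

lemma energy_sum_left:
  "finite I \<Longrightarrow> energy G L (\<lambda>v. \<Sum>i\<in>I. c i * f i v) h = (\<Sum>i\<in>I. c i * energy G L (f i) h)"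
proof (induction I rule: finite_induct)
  case empty
  then show ?case by (simp add: energy_def)
next
  case (insert i I)
  then show ?case
    using energy_add_left[of G L "\<lambda>v. c i * f i v" "\<lambda>v. \<Sum>i\<in>I. c i * f i v" h]
    by (simp add: energy_scale_left)
qed

lemma energy_cong_diff:
  assumes "\<And>e. e \<in> arcs G \<Longrightarrow> f (head G e) - f (tail G e) = f' (head G e) - f' (tail G e)"
    and "\<And>e. e \<in> arcs G \<Longrightarrow> g (head G e) - g (tail G e) = g' (head G e) - g' (tail G e)"
  shows "energy G L f g = energy G L f' g'"
  unfolding energy_def using assms by (intro sum.cong) simp_all

lemma energy_nonneg:
  "(\<And>e. e \<in> arcs G \<Longrightarrow> 0 < L e) \<Longrightarrow> 0 \<le> energy G L f f"
  unfolding energy_def by (intro sum_nonneg) (simp add: less_imp_le)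

lemma energy_eq_0D:
  assumes "finite (arcs G)" "\<And>e. e \<in> arcs G \<Longrightarrow> 0 < L e" "energy G L f f = 0" "e \<in> arcs G"
  shows "f (head G e) = f (tail G e)"
proof -
  have "(f (head G e) - f (tail G e)) * (f (head G e) - f (tail G e)) / L e = 0"
    using sum_nonneg_eq_0_iff[OF assms(1),
        of "\<lambda>e. (f (head G e) - f (tail G e)) * (f (head G e) - f (tail G e)) / L e"]
      assms by (simp add: energy_def less_imp_le)
  then show ?thesis using assms(2)[OF assms(4)] by simp
qed

section \<open>Kirchhoff's law in weak form\<close>

lemma sum_vertex_currents:
  assumes "fin_digraph G"
  shows "(\<Sum>v\<in>verts G. ((\<Sum>e\<in>out_arcs G v. (f v - f (head G e)) / L e)
        + (\<Sum>e\<in>in_arcs G v. (f v - f (tail G e)) / L e)) * g v) = energy G L f g"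
proof -
  interpret fin_digraph G by fact
  have "(\<Sum>v\<in>verts G. (\<Sum>e\<in>out_arcs G v. (f v - f (head G e)) / L e) * g v)
      = (\<Sum>v\<in>verts G. \<Sum>e\<in>{e\<in>arcs G. tail G e = v}. (f (tail G e) - f (head G e)) / L e * g (tail G e))"
    by (auto simp: out_arcs_def sum_distrib_right intro!: sum.cong)
  also have "\<dots> = (\<Sum>e\<in>arcs G. (f (tail G e) - f (head G e)) / L e * g (tail G e))"
    by (rule sum.group) auto
  finally have 1: "(\<Sum>v\<in>verts G. (\<Sum>e\<in>out_arcs G v. (f v - f (head G e)) / L e) * g v) = \<dots>" .
  have "(\<Sum>v\<in>verts G. (\<Sum>e\<in>in_arcs G v. (f v - f (tail G e)) / L e) * g v)
      = (\<Sum>v\<in>verts G. \<Sum>e\<in>{e\<in>arcs G. head G e = v}. (f (head G e) - f (tail G e)) / L e * g (head G e))"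
    by (auto simp: in_arcs_def sum_distrib_right intro!: sum.cong)
  also have "\<dots> = (\<Sum>e\<in>arcs G. (f (head G e) - f (tail G e)) / L e * g (head G e))"
    by (rule sum.group) auto
  finally have 2: "(\<Sum>v\<in>verts G. (\<Sum>e\<in>in_arcs G v. (f v - f (tail G e)) / L e) * g v) = \<dots>" .
  \<comment> \<open>Summation by parts: the two ends of an arc carry opposite currents, which turns
    the two values of \<open>g\<close> into their difference.\<close>
  show ?thesis
    by (simp add: distrib_right sum.distrib 1 2 energy_def)
      (auto simp: sum.distrib[symmetric] divide_inverse algebra_simps intro!: sum.cong)
qed

text \<open>Summing Kirchhoff's law against \<open>g\<close> gives the weak form; the indicator of a
  vertex as test function recovers the law at that vertex.\<close>

lemma unit_current_potential_iff_energy: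
  assumes "fin_digraph G" and p: "p \<in> verts G" and q: "q \<in> verts G"
  shows "unit_current_potential G L p q f \<longleftrightarrow> (\<forall>g. energy G L f g = g p - g q)"
proof -
  interpret fin_digraph G by fact
  define lap where "lap v = (\<Sum>e\<in>out_arcs G v. (f v - f (head G e)) / L e)
        + (\<Sum>e\<in>in_arcs G v. (f v - f (tail G e)) / L e)" for v
  define rhs :: "'a \<Rightarrow> real" where "rhs v = (if v = p then 1 else 0) - (if v = q then 1 else 0)" for v
  have lap: "(\<Sum>v\<in>verts G. lap v * g v) = energy G L f g" for g
    unfolding lap_def by (rule sum_vertex_currents) fact
  have rhs: "(\<Sum>v\<in>verts G. rhs v * g v) = g p - g q" for g :: "'a \<Rightarrow> real"
    using p q by (simp add: rhs_def left_diff_distrib sum_subtractf if_distrib[of "\<lambda>x. x * _"] cong: if_cong)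
  have "(\<forall>v\<in>verts G. lap v = rhs v) \<longleftrightarrow> (\<forall>g. energy G L f g = g p - g q)"
  proof
    assume "\<forall>v\<in>verts G. lap v = rhs v"
    then have "(\<Sum>v\<in>verts G. lap v * g v) = (\<Sum>v\<in>verts G. rhs v * g v)" for g
      by simp
    then show "\<forall>g. energy G L f g = g p - g q" by (simp add: lap rhs)
  next
    assume *: "\<forall>g. energy G L f g = g p - g q"
    show "\<forall>v\<in>verts G. lap v = rhs v"
    proof
      fix v assume v: "v \<in> verts G"
      have pick: "(\<Sum>w\<in>verts G. u w * (if w = v then 1 else 0)) = u v" for u :: "'a \<Rightarrow> real"
        using v by (simp add: if_distrib[of "\<lambda>x. _ * x"] cong: if_cong)
      show "lap v = rhs v"
        using * lap[of "\<lambda>w. if w = v then 1 else 0"] rhs[of "\<lambda>w. if w = v then 1 else 0"]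
        by (simp only: pick)
    qed
  qed
  then show ?thesis unfolding unit_current_potential_def lap_def rhs_def .
qed

text \<open>
  The value does not depend on the potential because of the symmetry of the energy form alone:
  two potentials \<open>f\<close> and \<open>f'\<close> satisfy \<open>f' p - f' q = energy f f' = energy f' f = f p - f q\<close>.
\<close>

lemma vertex_resistance_eqI:
  assumes "fin_digraph G" "p \<in> verts G" "q \<in> verts G" and f: "\<And>g. energy G L f g = g p - g q"
  shows "vertex_resistance G L p q = f p - f q"
  unfolding vertex_resistance_def
proof (rule the_equality)
  show "\<exists>f'. unit_current_potential G L p q f' \<and> f p - f q = f' p - f' q"
    using assms by (auto simp: unit_current_potential_iff_energy)
next
  fix r assume "\<exists>f'. unit_current_potential G L p q f' \<and> r = f' p - f' q"
  then obtain f' where "\<And>g. energy G L f' g = g p - g q" "r = f' p - f' q"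
    using assms by (auto simp: unit_current_potential_iff_energy)
  with f[of f'] show "r = f p - f q" by (metis energy_commute)
qed

section \<open>Connectedness and the existence of Green functions\<close>

lemma connected_iff_invariant_constant:
  assumes "wf_digraph G"
  shows "Digraph_Component.connected G \<longleftrightarrow> verts G \<noteq> {} \<and>
    (\<forall>h :: 'v \<Rightarrow> real. (\<forall>e\<in>arcs G. h (head G e) = h (tail G e)) \<longrightarrow>
       (\<forall>u\<in>verts G. \<forall>v\<in>verts (G :: ('v, 'e) pre_digraph). h u = h v))" (is "_ \<longleftrightarrow> ?R")
proof -
  interpret wf_digraph G by fact
  interpret S: pair_wf_digraph "mk_symmetric G" ..
  have ends: "(x, y) \<in> parcs (mk_symmetric G) \<longleftrightarrow>
      (\<exists>e\<in>arcs G. (x = tail G e \<and> y = head G e) \<or> (x = head G e \<and> y = tail G e))" for x y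
    by (auto simp: mk_symmetric_def)
  have V: "verts (with_proj (mk_symmetric G)) = verts G" by (simp add: mk_symmetric_def)
  show ?thesis
  proof
    assume con: "Digraph_Component.connected G"
    then have "verts G \<noteq> {}" by (simp add: connected_def strongly_connected_def V)
    moreover have "h u = h v" if h: "\<forall>e\<in>arcs G. h (head G e) = h (tail G e)"
      and uv: "u \<in> verts G" "v \<in> verts G" for h :: "'v \<Rightarrow> real" and u v
    proof -
      have "u \<rightarrow>\<^sup>*\<^bsub>mk_symmetric G\<^esub> v" using con uv by (simp add: connected_def strongly_connected_def V)
      then show ?thesis
        by (induction rule: S.reachable_induct) (use h in \<open>auto simp: ends\<close>)
    qed
    ultimately show ?R by blast
  next
    assume R: ?R
    show "Digraph_Component.connected G"
      unfolding connected_def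
    proof (rule strongly_connectedI)
      show "verts (with_proj (mk_symmetric G)) \<noteq> {}" using R V by simp
    next
      fix u v assume uv: "u \<in> verts (with_proj (mk_symmetric G))" "v \<in> verts (with_proj (mk_symmetric G))"
      \<comment> \<open>The indicator of the set reachable from \<open>u\<close> is constant along
        arcs, hence constant by assumption, hence 1 at \<open>v\<close>.\<close>
      define h :: "'v \<Rightarrow> real" where "h w = (if u \<rightarrow>\<^sup>*\<^bsub>mk_symmetric G\<^esub> w then 1 else 0)" for w
      have "h (head G e) = h (tail G e)" if "e \<in> arcs G" for e
      proof -
        have adj: "(tail G e, head G e) \<in> parcs (mk_symmetric G)"
          "(head G e, tail G e) \<in> parcs (mk_symmetric G)"
          using that by (auto simp: ends)
        have "u \<rightarrow>\<^sup>*\<^bsub>mk_symmetric G\<^esub> head G e \<longleftrightarrow> u \<rightarrow>\<^sup>*\<^bsub>mk_symmetric G\<^esub> tail G e"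
          by (rule iffI; erule S.reachable_adj_trans; rule adj)
        then show ?thesis by (simp add: h_def)
      qed
      then have "h u = h v" using R uv V by blast
      moreover have "h u = 1" using uv unfolding h_def by simp
      ultimately show "u \<rightarrow>\<^sup>*\<^bsub>mk_symmetric G\<^esub> v" by (simp add: h_def split: if_splits)
    qed
  qed
qed

text \<open>\<open>j v\<close> is the potential of a unit current from \<open>v\<close> to
  \<open>z\<close>, normalised to vanish at the ground \<open>z\<close>.\<close>

definition green ::
  "('v, 'e) pre_digraph \<Rightarrow> 'e weight_fun \<Rightarrow> 'v \<Rightarrow> ('v \<Rightarrow> 'v \<Rightarrow> real) \<Rightarrow> bool" where
  "green G L z j \<longleftrightarrow> z \<in> verts G \<and>
     (\<forall>v\<in>verts G. j v z = 0 \<and> (\<forall>g. energy G L (j v) g = g v - g z))"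

text \<open>As the values at \<open>z\<close> vanish, \<open>energy G L (j u) (j v)\<close> equals
  \<open>j v u\<close>, and with the arguments exchanged it equals \<open>j u v\<close>.\<close>

lemma green_commute:
  assumes "green G L z j" "u \<in> verts G" "v \<in> verts G"
  shows "j u v = j v u"
  using assms energy_commute[of G L "j u" "j v"] by (simp add: green_def)

text \<open>
  Gram-Schmidt: to pass from \<open>W\<close> to \<open>insert w W\<close>, the indicator of \<open>w\<close> is made
  energy-orthogonal to all functions supported on \<open>W\<close>. Connectedness is needed only for the
  resulting \<open>h\<close> to have nonzero energy.
\<close>

lemma green_exists_on:
  fixes G :: "('v, 'e) pre_digraph"
  assumes "fin_digraph G" and pos: "\<And>e. e \<in> arcs G \<Longrightarrow> 0 < L e"
    and con: "Digraph_Component.connected G" and z: "z \<in> verts G"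
  assumes "finite W" "W \<subseteq> verts G - {z}"
  shows "\<exists>j. \<forall>p\<in>W. (\<forall>v. v \<notin> W \<longrightarrow> j p v = 0) \<and>
           (\<forall>g. (\<forall>v. v \<notin> W \<longrightarrow> g v = 0) \<longrightarrow> energy G L (j p) g = g p)"
  using assms(5,6)
proof (induction W rule: finite_induct)
  case empty
  then show ?case by simp
next
  case (insert w W)
  interpret fin_digraph G by fact
  obtain j where j0: "\<And>p v. p \<in> W \<Longrightarrow> v \<notin> W \<Longrightarrow> j p v = 0"
    and jE: "\<And>p g. p \<in> W \<Longrightarrow> (\<And>v. v \<notin> W \<Longrightarrow> g v = 0) \<Longrightarrow> energy G L (j p) g = g p"
    using insert by (metis insert_subset)
  define d :: "'v \<Rightarrow> 'v \<Rightarrow> real" where "d u v = (if v = u then 1 else 0)" for u v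
  \<comment> \<open>The indicator of \<open>w\<close> minus its orthogonal projection onto the
    functions supported on \<open>W\<close>; the reproducing property of \<open>j\<close> yields the
    coefficients.\<close>
  define h where "h v = d w v - (\<Sum>u\<in>W. energy G L (d w) (d u) * j u v)" for v
  have hw: "h w = 1" using insert j0 by (simp add: h_def d_def)
  have h0: "h v = 0" if "v \<notin> insert w W" for v using that j0 by (simp add: h_def d_def)
  have orth: "energy G L h g = 0" if g: "\<And>v. v \<notin> W \<Longrightarrow> g v = 0" for g
  proof -
    have geq: "g = (\<lambda>v. \<Sum>u\<in>W. g u * d u v)"
      using g insert by (auto simp: d_def fun_eq_iff if_distrib[of "\<lambda>x. _ * x"] cong: if_cong)
    have "energy G L h g = energy G L (d w) g - (\<Sum>u\<in>W. energy G L (d w) (d u) * g u)"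
      unfolding h_def using insert jE g by (simp add: energy_diff_left energy_sum_left)
    also have "energy G L (d w) g = (\<Sum>u\<in>W. energy G L (d w) (d u) * g u)"
      by (subst geq, subst energy_commute, subst energy_sum_left)
        (use insert in \<open>auto simp: energy_commute mult.commute\<close>)
    finally show ?thesis by simp
  qed
  \<comment> \<open>Zero energy would make \<open>h\<close> constant on the connected graph, but it
    is 1 at \<open>w\<close> and 0 at \<open>z\<close>.\<close>
  have "energy G L h h \<noteq> 0"
  proof
    assume "energy G L h h = 0"
    then have "\<forall>e\<in>arcs G. h (head G e) = h (tail G e)" using pos energy_eq_0D by (metis finite_arcs)
    then have "h w = h z" using con z insert by (auto simp: connected_iff_invariant_constant[OF wf_digraph])
    moreover have "h z = 0" using insert.prems by (intro h0) auto
    ultimately show False using hw by simp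
  qed
  define c where "c = energy G L h h"
  have c: "c \<noteq> 0" unfolding c_def by fact
  \<comment> \<open>The reproducing kernel of an orthogonal sum: the old kernel plus the rank-one
    kernel of the line spanned by \<open>h\<close>. For \<open>p = w\<close> only the latter
    remains, as \<open>h w = 1\<close>.\<close>
  define j' where "j' p v = (if p = w then h v / c else j p v + h p / c * h v)" for p v
  have "energy G L (j' p) g = g p" if p: "p \<in> insert w W" and g: "\<And>v. v \<notin> insert w W \<Longrightarrow> g v = 0" for p g
  proof -
    \<comment> \<open>Subtracting \<open>g w\<close> times \<open>h\<close> removes the value at
      \<open>w\<close>, so the orthogonality of \<open>h\<close> and the induction hypothesis apply
      to \<open>g'\<close>.\<close>
    define g' where "g' v = g v - g w * h v" for v
    have g': "g' v = 0" if "v \<notin> W" for v using that g hw h0 by (cases "v = w") (auto simp: g'_def)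
    have split: "energy G L f g = energy G L f g' + g w * energy G L f h" for f
    proof -
      have "energy G L g f = energy G L (\<lambda>v. g' v + g w * h v) f" by (simp add: g'_def)
      then show ?thesis by (simp add: energy_add_left energy_scale_left energy_commute)
    qed
    have hg: "energy G L h g = g w * c" using split[of h] orth[OF g'] by (simp add: c_def)
    show ?thesis
    proof (cases "p = w")
      case True
      then have "j' p = (\<lambda>v. (1 / c) * h v)" by (simp add: j'_def fun_eq_iff)
      then show ?thesis by (simp only: energy_scale_left hg) (use c True in simp)
    next
      case False
      then have pW: "p \<in> W" using p by simp
      have "energy G L (j p) h = 0" by (subst energy_commute, rule orth) (use j0 pW in auto)
      then have jg: "energy G L (j p) g = g' p" using split[of "j p"] jE[OF pW g'] by simp
      have "j' p = (\<lambda>v. j p v + (h p / c) * h v)" using False by (simp add: j'_def fun_eq_iff)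
      then show ?thesis
        by (simp only: energy_add_left energy_scale_left hg jg) (use c in \<open>simp add: g'_def\<close>)
    qed
  qed
  moreover have "j' p v = 0" if "p \<in> insert w W" "v \<notin> insert w W" for p v
    using that h0 j0 by (auto simp: j'_def)
  ultimately show ?case by blast
qed

text \<open>The kernel on all vertices except \<open>z\<close>, with a zero row added at
  \<open>z\<close>. A test function that does not vanish at \<open>z\<close> is shifted by a
  constant, which the energy does not see.\<close>

lemma green_exists:
  fixes G :: "('v, 'e) pre_digraph"
  assumes "metrized_graph G L" and z: "z \<in> verts G"
  shows "\<exists>j. green G L z j"
proof -
  have fin: "fin_digraph G" and con: "Digraph_Component.connected G"
    and pos: "\<And>e. e \<in> arcs G \<Longrightarrow> 0 < L e"
    using assms by (auto simp: metrized_graph_def)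
  interpret fin_digraph G by fact
  let ?W = "verts G - {z}"
  obtain j where j: "\<forall>p\<in>?W. (\<forall>v. v \<notin> ?W \<longrightarrow> j p v = 0) \<and>
           (\<forall>g. (\<forall>v. v \<notin> ?W \<longrightarrow> g v = 0) \<longrightarrow> energy G L (j p) g = g p)"
  proof (rule exE[OF green_exists_on[OF fin _ con z, where W = ?W and L = L]])
    show "finite ?W" "?W \<subseteq> ?W" and "\<And>e. e \<in> arcs G \<Longrightarrow> 0 < L e" by (simp_all add: pos)
  qed
  have j0: "j p v = 0" if "p \<in> ?W" "v \<notin> ?W" for p v
    using bspec[OF j that(1)] that(2) by blast
  have jE: "energy G L (j p) g = g p" if "p \<in> ?W" "\<And>v. v \<notin> ?W \<Longrightarrow> g v = 0" for p g
    using bspec[OF j that(1)] that(2) by blast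
  define j' where "j' v = (if v = z then (\<lambda>_. 0) else j v)" for v
  have "energy G L (j' v) g = g v - g z" if v: "v \<in> verts G" for v g
  proof (cases "v = z")
    case True
    then show ?thesis by (simp add: j'_def energy_def)
  next
    case False
    \<comment> \<open>The shifted function is also set to 0 outside the vertex set, because the
      support condition in \<open>jE\<close> ranges over the whole type.\<close>
    define g' where "g' u = (if u \<in> ?W then g u - g z else 0)" for u
    have "energy G L (j v) g = energy G L (j v) g'"
      by (rule energy_cong_diff) (auto simp: g'_def)
    also have "\<dots> = g' v" using v False by (intro jE) (auto simp: g'_def)
    finally show ?thesis using v False by (simp add: j'_def g'_def)
  qed
  moreover have "j' v z = 0" if "v \<in> verts G" for v using that j0 by (auto simp: j'_def)
  ultimately show ?thesis using z by (auto simp: green_def)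
qed

subsection \<open>Sums and integrals over consecutive cuts\<close>

definition consecutive :: "real set \<Rightarrow> (real \<times> real) set" where
  "consecutive C = {(a, b). a \<in> C \<and> b \<in> C \<and> a < b \<and> {a<..<b} \<inter> C = {}}"

lemma finite_consecutive: "finite C \<Longrightarrow> finite (consecutive C)"
  by (rule finite_subset[of _ "C \<times> C"]) (auto simp: consecutive_def)

lemma consecutive_singleton [simp]: "consecutive {c} = {}"
  by (auto simp: consecutive_def)

lemma consecutive_not_between: "(a, b) \<in> consecutive C \<Longrightarrow> c \<in> C \<Longrightarrow> b \<le> c \<or> c \<le> a"
  by (force simp: consecutive_def)

text \<open>The induction step for telescoping sums and for integrals over adjacent intervals: a
  point beyond all others adds one pair and destroys none.\<close>

lemma consecutive_insert_greatest:
  assumes "finite C" "C \<noteq> {}" "\<And>c. c \<in> C \<Longrightarrow> c < m"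
  shows "consecutive (insert m C) = insert (Max C, m) (consecutive C)"
proof -
  have M: "Max C \<in> C" "\<And>c. c \<in> C \<Longrightarrow> c \<le> Max C" using assms by auto
  show ?thesis
  proof (intro set_eqI iffI)
    fix p assume "p \<in> consecutive (insert m C)"
    then obtain a b where p: "p = (a, b)" "a \<in> insert m C" "b \<in> insert m C" "a < b"
      "{a<..<b} \<inter> insert m C = {}"
      by (auto simp: consecutive_def)
    have "a \<in> C" using p assms(3) by (metis insertE less_asym less_irrefl)
    show "p \<in> insert (Max C, m) (consecutive C)"
    proof (cases "b = m")
      case True
      have "\<not> a < Max C" using p True M assms(3)[OF M(1)] by auto
      then have "a = Max C" using M \<open>a \<in> C\<close> by (meson antisym not_less)
      with True p show ?thesis by simp
    next
      case False
      then show ?thesis using p \<open>a \<in> C\<close> by (auto simp: consecutive_def)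
    qed
  next
    fix p assume "p \<in> insert (Max C, m) (consecutive C)"
    then show "p \<in> consecutive (insert m C)"
      using M assms(3) by (fastforce simp: consecutive_def)
  qed
qed

lemma sum_consecutive:
  fixes f :: "real \<Rightarrow> real"
  assumes "finite C" "C \<noteq> {}"
  shows "(\<Sum>(a, b)\<in>consecutive C. f b - f a) = f (Max C) - f (Min C)"
  using assms
proof (induction C rule: finite_linorder_max_induct)
  case empty
  then show ?case by simp
next
  case (insert m C)
  show ?case
  proof (cases "C = {}")
    case True
    then show ?thesis by simp
  next
    case False
    have M: "Max (insert m C) = m" using insert False by (auto intro!: Max_eqI simp: less_imp_le)
    have N: "Min (insert m C) = Min C"
      using insert False by (simp add: min_absorb2 less_imp_le)
    have new: "(Max C, m) \<notin> consecutive C" using insert by (auto simp: consecutive_def)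
    show ?thesis
      using insert False new
      by (simp add: consecutive_insert_greatest finite_consecutive M N)
  qed
qed

lemma has_integral_consecutive:
  fixes f :: "real \<Rightarrow> real"
  assumes "finite C" "C \<noteq> {}"
    and "\<And>a b. (a, b) \<in> consecutive C \<Longrightarrow> (f has_integral I a b) {a..b}"
  shows "(f has_integral (\<Sum>(a, b)\<in>consecutive C. I a b)) {Min C..Max C}"
  using assms
proof (induction C rule: finite_linorder_max_induct)
  case empty
  then show ?case by simp
next
  case (insert m C)
  show ?case
  proof (cases "C = {}")
    case True
    then show ?thesis by (simp add: has_integral_refl)
  next
    case False
    have M: "Max (insert m C) = m" using insert False by (auto intro!: Max_eqI simp: less_imp_le)
    have N: "Min (insert m C) = Min C"
      using insert False by (simp add: min_absorb2 less_imp_le)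
    have new: "(Max C, m) \<notin> consecutive C" using insert by (auto simp: consecutive_def)
    have eq: "consecutive (insert m C) = insert (Max C, m) (consecutive C)"
      using insert False by (intro consecutive_insert_greatest) auto
    have "(f has_integral (\<Sum>(a, b)\<in>consecutive C. I a b)) {Min C..Max C}"
      using insert False eq by auto
    moreover have "(f has_integral I (Max C) m) {Max C..m}" using insert.prems eq by auto
    ultimately have "(f has_integral (\<Sum>(a, b)\<in>consecutive C. I a b) + I (Max C) m) {Min C..m}"
      using insert False by (intro has_integral_combine) (auto simp: less_imp_le)
    then show ?thesis
      using insert new by (simp add: eq M N finite_consecutive add.commute)
  qed
qed

text \<open>With \<rho>' = \<beta> + 2 \<gamma> s - 2 \<kappa>, the square is (\<beta> + 2 \<gamma>
  s)^2 - 4 \<kappa> (\<beta> + 2 \<gamma> s - \<kappa>), and \<open>H\<close> is a primitive of the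
  first term. The slope \<kappa>, which will come from the base point, is kept apart so that its
  contribution can be recognised as an energy.\<close>

lemma has_integral_deriv_square_quadratic:
  fixes \<rho> :: "real \<Rightarrow> real"
  assumes "a < b"
    and \<rho>: "\<And>s. s \<in> {a<..<b} \<Longrightarrow> \<rho> s = \<alpha> + \<beta> * s + \<gamma> * s\<^sup>2 - 2 * \<kappa> * s"
  defines "H \<equiv> \<lambda>s. \<beta>\<^sup>2 * s + 2 * \<beta> * \<gamma> * s\<^sup>2 + 4 / 3 * \<gamma>\<^sup>2 * s ^ 3"
  shows "((\<lambda>t. (deriv \<rho> t)\<^sup>2) has_integral
           (H b - H a) - 4 * \<kappa> * ((\<beta> * b + \<gamma> * b\<^sup>2) - (\<beta> * a + \<gamma> * a\<^sup>2) - \<kappa> * (b - a))) {a..b}"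
proof -
  define \<Phi> where "\<Phi> s = H s - 4 * \<kappa> * (\<beta> * s + \<gamma> * s\<^sup>2 - \<kappa> * s)" for s
  have d: "deriv \<rho> t = \<beta> + 2 * \<gamma> * t - 2 * \<kappa>" if t: "t \<in> {a<..<b}" for t
  proof -
    have "((\<lambda>s. \<alpha> + \<beta> * s + \<gamma> * s\<^sup>2 - 2 * \<kappa> * s) has_field_derivative (\<beta> + 2 * \<gamma> * t - 2 * \<kappa>)) (at t)"
      by (auto intro!: derivative_eq_intros)
    then have "(\<rho> has_field_derivative (\<beta> + 2 * \<gamma> * t - 2 * \<kappa>)) (at t)"
      by (rule has_field_derivative_transform_within_open[of _ _ _ "{a<..<b}"]) (use t \<rho> in auto)
    then show ?thesis by (rule DERIV_imp_deriv)
  qed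
  have "(\<Phi> has_vector_derivative (deriv \<rho> t)\<^sup>2) (at t)" if t: "t \<in> {a<..<b}" for t
    unfolding d[OF t] \<Phi>_def H_def has_real_derivative_iff_has_vector_derivative[symmetric]
    by (auto intro!: derivative_eq_intros simp: power2_eq_square algebra_simps)
  moreover have "continuous_on {a..b} \<Phi>"
    unfolding \<Phi>_def H_def by (intro continuous_intros)
  ultimately have "((\<lambda>t. (deriv \<rho> t)\<^sup>2) has_integral \<Phi> b - \<Phi> a) {a..b}"
    using \<open>a < b\<close> by (intro fundamental_theorem_of_calculus_interior) auto
  then show ?thesis by (simp add: \<Phi>_def algebra_simps)
qed

subsection \<open>Subdivisions\<close>

text \<open>A metrized graph without the demand of connectedness, so that the graph with one edge
  deleted is an instance as well.\<close>

locale resistor_network = fin_digraph G for G :: "('v, 'e) pre_digraph" +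
  fixes L :: "'e weight_fun"
  assumes length_pos: "e \<in> arcs G \<Longrightarrow> 0 < L e"
begin

lemma length_nonzero: "e \<in> arcs G \<Longrightarrow> L e \<noteq> 0"
  using length_pos by force

lemma edge_point_0 [simp]: "edge_point G L e 0 = Vertex (tail G e)"
  by (simp add: edge_point_def)

lemma edge_point_length: "e \<in> arcs G \<Longrightarrow> edge_point G L e (L e) = Vertex (head G e)"
  using length_pos by (force simp: edge_point_def)

lemma edge_point_in_points:
  "e \<in> arcs G \<Longrightarrow> 0 \<le> t \<Longrightarrow> t \<le> L e \<Longrightarrow> edge_point G L e t \<in> points G L"
  by (auto simp: edge_point_def points_def)

lemma finite_cuts: "finite S \<Longrightarrow> finite (cuts L S e)"
  using finite_vimageI[of S "Inner e"] by (auto simp: cuts_def vimage_def inj_def)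

lemma cuts_bounds:
  assumes "S \<subseteq> points G L" "e \<in> arcs G" "t \<in> cuts L S e"
  shows "0 \<le> t" "t \<le> L e"
  using assms length_pos[OF assms(2)] by (auto simp: cuts_def points_def)

lemma Min_cuts:
  assumes "S \<subseteq> points G L" "finite S" "e \<in> arcs G"
  shows "Min (cuts L S e) = 0"
  using assms cuts_bounds by (intro Min_eqI finite_cuts) (auto simp: cuts_def)

lemma Max_cuts:
  assumes "S \<subseteq> points G L" "finite S" "e \<in> arcs G"
  shows "Max (cuts L S e) = L e"
  using assms cuts_bounds by (intro Max_eqI finite_cuts) (auto simp: cuts_def)

lemma cuts_nonempty: "cuts L S e \<noteq> {}"
  by (simp add: cuts_def)

lemma sum_cuts:
  fixes f :: "real \<Rightarrow> real"
  assumes "S \<subseteq> points G L" "finite S" "e \<in> arcs G"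
  shows "(\<Sum>(a, b)\<in>consecutive (cuts L S e). f b - f a) = f (L e) - f 0"
  using sum_consecutive[OF finite_cuts[OF assms(2)] cuts_nonempty, of f e] assms
  by (simp add: Min_cuts Max_cuts)

text \<open>Sums over segments become double sums, whose inner sums telescope along one
  edge.\<close>

lemma arcs_subdivide:
  "arcs (subdivide G L S) = Sigma (arcs G) (\<lambda>e. consecutive (cuts L S e))"
  by (auto simp: subdivide_def consecutive_def)

lemma verts_subdivide: "verts (subdivide G L S) = Vertex ` verts G \<union> S"
  by (simp add: subdivide_def)

lemma fin_digraph_subdivide:
  assumes "S \<subseteq> points G L" "finite S"
  shows "fin_digraph (subdivide G L S)"
proof
  have "edge_point G L e t \<in> Vertex ` verts G \<union> S" if "e \<in> arcs G" "t \<in> cuts L S e" for e t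
    using that by (auto simp: edge_point_def cuts_def)
  then show "tail (subdivide G L S) s \<in> verts (subdivide G L S)"
    and "head (subdivide G L S) s \<in> verts (subdivide G L S)"
    if "s \<in> arcs (subdivide G L S)" for s
    using that by (auto simp: subdivide_def)
  show "finite (verts (subdivide G L S))" using assms by (simp add: verts_subdivide)
  show "finite (arcs (subdivide G L S))"
    unfolding arcs_subdivide using assms by (auto intro!: finite_SigmaI finite_consecutive finite_cuts)
qed

lemma energy_subdivide:
  assumes "finite S"
  shows "energy (subdivide G L S) segment_length f g =
    (\<Sum>e\<in>arcs G. \<Sum>(a, b)\<in>consecutive (cuts L S e).
       (f (edge_point G L e b) - f (edge_point G L e a)) *
       (g (edge_point G L e b) - g (edge_point G L e a)) / (b - a))"
  unfolding energy_def arcs_subdivide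
  by (subst sum.Sigma)
    (auto simp: assms finite_consecutive finite_cuts subdivide_def segment_length_def intro!: sum.cong)

end

text \<open>
  The Green function of a single edge with both ends grounded is the tent
  \<open>min t t' * (L e - max t t') / L e\<close>; the kernel below adds it to the bilinear interpolation of
  the Green function on the vertices and is a Green function on all points.
\<close>

definition interpolate ::
  "('v, 'e) pre_digraph \<Rightarrow> 'e weight_fun \<Rightarrow> ('v \<Rightarrow> real) \<Rightarrow> ('v, 'e) point \<Rightarrow> real" where
  "interpolate G L f x = (case x of Vertex v \<Rightarrow> f v
     | Inner e t \<Rightarrow> (1 - t / L e) * f (tail G e) + t / L e * f (head G e))"

definition tent :: "'e weight_fun \<Rightarrow> ('v, 'e) point \<Rightarrow> ('v, 'e) point \<Rightarrow> real" where
  "tent L x y = (case x of Vertex v \<Rightarrow> 0 | Inner e t \<Rightarrow> (case y of Vertex v \<Rightarrow> 0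
     | Inner e' t' \<Rightarrow> if e = e' then min t t' * (L e - max t t') / L e else 0))"

definition kernel ::
  "('v, 'e) pre_digraph \<Rightarrow> 'e weight_fun \<Rightarrow> ('v \<Rightarrow> 'v \<Rightarrow> real)
     \<Rightarrow> ('v, 'e) point \<Rightarrow> ('v, 'e) point \<Rightarrow> real" where
  "kernel G L j x y = interpolate G L (\<lambda>u. interpolate G L (j u) y) x + tent L x y"

lemma interpolate_Vertex [simp]: "interpolate G L f (Vertex v) = f v"
  by (simp add: interpolate_def)

lemma tent_Vertex [simp]: "tent L (Vertex v) y = 0" "tent L x (Vertex v) = 0"
  by (auto simp: tent_def split: point.split)

lemma tent_commute: "tent L x y = tent L y x"
  by (auto simp: tent_def min.commute max.commute split: point.split)

text \<open>Interpolations in two separate variables commute. Naming the quotients \<open>a\<close>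
  and \<open>b\<close> leaves a polynomial identity.\<close>

lemma interpolate_swap:
  "interpolate G L (\<lambda>u. interpolate G L (j u) y) x = interpolate G L (\<lambda>v. interpolate G L (\<lambda>u. j u v) x) y"
proof (cases x; cases y)
  fix e t e' t' assume "x = Inner e t" "y = Inner e' t'"
  moreover define a b where "a = t / L e" and "b = t' / L e'"
  ultimately show ?thesis
    by (simp only: interpolate_def point.case a_def[symmetric] b_def[symmetric])
      (simp add: algebra_simps)
qed (simp_all add: interpolate_def)

lemma kernel_conv_interpolate:
  "kernel G L j x y = interpolate G L (\<lambda>v. interpolate G L (\<lambda>u. j u v) x) y + tent L x y"
  using interpolate_swap[of G L j y x] by (simp only: kernel_def)

lemma interpolate_diff_const:
  "interpolate G L (\<lambda>u. f u - c) x = interpolate G L f x - c"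
  by (cases x) (simp_all add: interpolate_def algebra_simps)

lemma energy_interpolate_left:
  "energy G L (\<lambda>v. interpolate H M (\<lambda>u. j u v) x) g = interpolate H M (\<lambda>u. energy G L (j u) g) x"
  by (cases x) (simp_all only: interpolate_def point.case energy_add_left energy_scale_left)

context resistor_network
begin

section \<open>Energies of the two parts of the kernel on a subdivision\<close>

lemma interpolate_edge_point:
  assumes "e \<in> arcs G"
  shows "interpolate G L f (edge_point G L e t) = f (tail G e) + t * ((f (head G e) - f (tail G e)) / L e)"
  using length_nonzero[OF assms] by (auto simp: interpolate_def edge_point_def divide_simps algebra_simps)

lemma interpolate_cong:
  assumes "x \<in> points G L" "\<And>v. v \<in> verts G \<Longrightarrow> f v = g v"
  shows "interpolate G L f x = interpolate G L g x"
  using assms by (auto simp: interpolate_def points_def)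

text \<open>This form shows the slopes \<open>1 - t\<^sub>0 / L e\<close> before
  \<open>t\<^sub>0\<close> and \<open>- t\<^sub>0 / L e\<close> after it; the slope drops by 1,
  which is the unit current injected there.\<close>

lemma tent_edge_point:
  assumes "e \<in> arcs G" "0 \<le> t" "t \<le> L e" "Inner e\<^sub>0 t\<^sub>0 \<in> points G L"
  shows "tent L (Inner e\<^sub>0 t\<^sub>0) (edge_point G L e t) =
    (if e = e\<^sub>0 then (if t \<le> t\<^sub>0 then t * (1 - t\<^sub>0 / L e) else t\<^sub>0 * (1 - t / L e)) else 0)"
proof (cases "e = e\<^sub>0")
  case False
  then show ?thesis by (simp add: tent_def edge_point_def)
next
  case True
  have t0: "0 < t\<^sub>0" "t\<^sub>0 < L e" using assms(4) True by (auto simp: points_def)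
  consider "t = 0" | "t = L e" | "0 < t" "t < L e" using assms(2,3) by fastforce
  then show ?thesis
  proof cases
    case 1
    then show ?thesis using t0 by simp
  next
    case 2
    then show ?thesis using t0 True assms(1) by (simp add: edge_point_length)
  next
    case 3
    then show ?thesis
      using t0 True by (simp add: tent_def edge_point_def min_def max_def field_simps)
  qed
qed

text \<open>An interpolated function has one slope \<open>c\<close> per edge, so the segments of the
  edge telescope to \<open>c\<close> times the difference of \<open>g\<close> at its ends.\<close>

lemma energy_subdivide_interpolate:
  assumes "S \<subseteq> points G L" "finite S"
  shows "energy (subdivide G L S) segment_length (interpolate G L f) g = energy G L f (\<lambda>v. g (Vertex v))"
proof -
  have "(\<Sum>(a, b)\<in>consecutive (cuts L S e).
       (interpolate G L f (edge_point G L e b) - interpolate G L f (edge_point G L e a)) *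
       (g (edge_point G L e b) - g (edge_point G L e a)) / (b - a)) =
     (f (head G e) - f (tail G e)) * (g (Vertex (head G e)) - g (Vertex (tail G e))) / L e"
    if e: "e \<in> arcs G" for e
  proof -
    define c where "c = (f (head G e) - f (tail G e)) / L e"
    have "(\<Sum>(a, b)\<in>consecutive (cuts L S e).
       (interpolate G L f (edge_point G L e b) - interpolate G L f (edge_point G L e a)) *
       (g (edge_point G L e b) - g (edge_point G L e a)) / (b - a)) =
      (\<Sum>(a, b)\<in>consecutive (cuts L S e). c * g (edge_point G L e b) - c * g (edge_point G L e a))"
      by (rule sum.cong)
        (auto simp: interpolate_edge_point[OF e] c_def[symmetric] consecutive_def divide_simps algebra_simps)
    also have "\<dots> = c * g (edge_point G L e (L e)) - c * g (edge_point G L e 0)"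
      by (rule sum_cuts[OF assms e])
    also have "\<dots> = (f (head G e) - f (tail G e)) * (g (Vertex (head G e)) - g (Vertex (tail G e))) / L e"
      by (simp add: edge_point_length[OF e] c_def left_diff_distrib right_diff_distrib diff_divide_distrib)
    finally show ?thesis .
  qed
  then show ?thesis
    by (subst energy_subdivide[OF assms(2)]) (simp add: energy_def)
qed

text \<open>The tent at \<open>x\<close> injects a unit current at \<open>x\<close> and withdraws it
  at the two ends of the edge, with the weights of linear interpolation.\<close>

lemma energy_subdivide_tent:
  assumes S: "S \<subseteq> points G L" "finite S" and x: "x \<in> Vertex ` verts G \<union> S"
  shows "energy (subdivide G L S) segment_length (tent L x) g = g x - interpolate G L (\<lambda>v. g (Vertex v)) x"
proof (cases x)
  case (Vertex v)
  then show ?thesis by (simp add: energy_def)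
next
  case (Inner e\<^sub>0 t\<^sub>0)
  then have xS: "Inner e\<^sub>0 t\<^sub>0 \<in> S" and xp: "Inner e\<^sub>0 t\<^sub>0 \<in> points G L" using x S by auto
  then have e0: "e\<^sub>0 \<in> arcs G" and t0: "0 < t\<^sub>0" "t\<^sub>0 < L e\<^sub>0" by (auto simp: points_def)
  define T where "T e = (\<Sum>(a, b)\<in>consecutive (cuts L S e).
       (tent L x (edge_point G L e b) - tent L x (edge_point G L e a)) *
       (g (edge_point G L e b) - g (edge_point G L e a)) / (b - a))" for e
  have "T e = 0" if e: "e \<in> arcs G" "e \<noteq> e\<^sub>0" for e
    unfolding T_def using e cuts_bounds[OF S(1) e(1)]
    by (intro sum.neutral) (auto simp: Inner tent_edge_point[OF e(1) _ _ xp] consecutive_def)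
  then have "(\<Sum>e\<in>arcs G. T e) = T e\<^sub>0"
    using sum.remove[of "arcs G" e\<^sub>0 T] e0 by simp
  moreover have "T e\<^sub>0 = g x - interpolate G L (\<lambda>v. g (Vertex v)) x"
  proof -
    define \<gamma> where "\<gamma> t = g (edge_point G L e\<^sub>0 t)" for t
    \<comment> \<open>Subtracting \<open>\<gamma> t\<^sub>0\<close> makes both branches vanish at
      \<open>t\<^sub>0\<close>, so the second formula also holds there and the segment terms
      telescope across the kink.\<close>
    define \<psi> where "\<psi> t = (if t \<le> t\<^sub>0 then (1 - t\<^sub>0 / L e\<^sub>0) * (\<gamma> t - \<gamma> t\<^sub>0)
                                 else - (t\<^sub>0 / L e\<^sub>0) * (\<gamma> t - \<gamma> t\<^sub>0))" for t
    have "(tent L x (edge_point G L e\<^sub>0 b) - tent L x (edge_point G L e\<^sub>0 a)) *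
       (g (edge_point G L e\<^sub>0 b) - g (edge_point G L e\<^sub>0 a)) / (b - a) = \<psi> b - \<psi> a"
      if ab: "(a, b) \<in> consecutive (cuts L S e\<^sub>0)" for a b
    proof -
      have "a \<in> cuts L S e\<^sub>0" "b \<in> cuts L S e\<^sub>0" "a < b" using ab by (auto simp: consecutive_def)
      then have bd: "0 \<le> a" "a < b" "b \<le> L e\<^sub>0" using cuts_bounds[OF S(1) e0] by auto
      \<comment> \<open>Because \<open>x\<close> is one of the cuts, no segment straddles the
        kink.\<close>
      have "t\<^sub>0 \<in> cuts L S e\<^sub>0" using xS by (simp add: cuts_def)
      then consider "b \<le> t\<^sub>0" | "t\<^sub>0 \<le> a" using consecutive_not_between[OF ab] by blast
      then show ?thesis
      proof cases
        case 1
        have "tent L x (edge_point G L e\<^sub>0 b) - tent L x (edge_point G L e\<^sub>0 a) = (b - a) * (1 - t\<^sub>0 / L e\<^sub>0)"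
          using bd 1 by (simp add: Inner tent_edge_point[OF e0 _ _ xp] left_diff_distrib)
        moreover have "\<psi> b - \<psi> a = (1 - t\<^sub>0 / L e\<^sub>0) * (g (edge_point G L e\<^sub>0 b) - g (edge_point G L e\<^sub>0 a))"
          using bd 1 by (simp add: \<psi>_def \<gamma>_def algebra_simps)
        ultimately show ?thesis using bd by simp
      next
        case 2
        have "tent L x (edge_point G L e\<^sub>0 t) = t\<^sub>0 * (1 - t / L e\<^sub>0)" if "t\<^sub>0 \<le> t" "t \<le> L e\<^sub>0" for t
          using that t0 by (auto simp: Inner tent_edge_point[OF e0 _ _ xp])
        then have "tent L x (edge_point G L e\<^sub>0 b) - tent L x (edge_point G L e\<^sub>0 a) = (b - a) * (- (t\<^sub>0 / L e\<^sub>0))"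
          using bd 2 t0 by (simp add: divide_simps algebra_simps)
        moreover have "\<psi> t = - (t\<^sub>0 / L e\<^sub>0) * (\<gamma> t - \<gamma> t\<^sub>0)" if "t\<^sub>0 \<le> t" for t
          using that by (auto simp: \<psi>_def)
        then have "\<psi> b - \<psi> a = - (t\<^sub>0 / L e\<^sub>0) * (g (edge_point G L e\<^sub>0 b) - g (edge_point G L e\<^sub>0 a))"
          using bd 2 by (simp add: \<gamma>_def algebra_simps)
        ultimately show ?thesis using bd by simp
      qed
    qed
    then have "T e\<^sub>0 = (\<Sum>(a, b)\<in>consecutive (cuts L S e\<^sub>0). \<psi> b - \<psi> a)"
      unfolding T_def by (intro sum.cong) auto
    also have "\<dots> = \<psi> (L e\<^sub>0) - \<psi> 0" by (rule sum_cuts[OF S e0])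
    also have "\<dots> = g x - interpolate G L (\<lambda>v. g (Vertex v)) x"
      using t0 by (simp add: \<psi>_def \<gamma>_def edge_point_length[OF e0] Inner interpolate_def)
        (simp add: edge_point_def algebra_simps diff_divide_distrib)
    finally show ?thesis .
  qed
  ultimately show ?thesis by (simp add: energy_subdivide[OF S(2)] T_def)
qed

end

subsection \<open>The tau constant in terms of the Green function\<close>

locale grounded_network = resistor_network G L for G :: "('v, 'e) pre_digraph" and L +
  fixes z :: 'v and j :: "'v \<Rightarrow> 'v \<Rightarrow> real"
  assumes green: "green G L z j"
begin

abbreviation "K \<equiv> kernel G L j"

text \<open>The effective resistance between the ends of \<open>e\<close> in the whole graph, with
  \<open>e\<close> itself included.\<close>

definition edge_resistance :: "'e \<Rightarrow> real" where
  "edge_resistance e = j (tail G e) (tail G e) + j (head G e) (head G e) - 2 * j (tail G e) (head G e)"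

lemma ground_in_verts: "z \<in> verts G"
  using green by (simp add: green_def)

lemma kernel_commute:
  assumes "x \<in> points G L" "y \<in> points G L"
  shows "K x y = K y x"
proof -
  have "interpolate G L (\<lambda>u. interpolate G L (j u) y) x
      = interpolate G L (\<lambda>u. interpolate G L (\<lambda>v. j v u) y) x"
    using assms by (intro interpolate_cong) (simp_all add: green_commute[OF green])
  then show ?thesis
    by (simp add: kernel_def[of _ _ _ x y] kernel_conv_interpolate[of _ _ _ y x] tent_commute)
qed

lemma kernel_ground: "y \<in> points G L \<Longrightarrow> K y (Vertex z) = 0"
  using green interpolate_cong[of y "\<lambda>u. j u z" "\<lambda>_. 0"]
  by (simp add: kernel_def green_def) (simp add: interpolate_def split: point.split)

text \<open>The interpolated part injects current at the ends of the edge containing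
  \<open>x\<close>, and the tent moves it to \<open>x\<close>: the two interpolated values of
  \<open>g\<close> cancel.\<close>

lemma energy_kernel:
  assumes S: "S \<subseteq> points G L" "finite S" and x: "x \<in> Vertex ` verts G \<union> S"
  shows "energy (subdivide G L S) segment_length (K x) g = g x - g (Vertex z)"
proof -
  let ?F = "\<lambda>v. interpolate G L (\<lambda>u. j u v) x"
  have xp: "x \<in> points G L" using x S by (auto simp: points_def)
  have "energy G L ?F (\<lambda>v. g (Vertex v)) = interpolate G L (\<lambda>u. energy G L (j u) (\<lambda>v. g (Vertex v))) x"
    by (rule energy_interpolate_left)
  also have "\<dots> = interpolate G L (\<lambda>u. g (Vertex u) - g (Vertex z)) x"
    using green by (intro interpolate_cong xp) (simp add: green_def)
  also have "\<dots> = interpolate G L (\<lambda>u. g (Vertex u)) x - g (Vertex z)"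
    by (rule interpolate_diff_const)
  finally show ?thesis
    unfolding kernel_conv_interpolate[abs_def]
    by (simp add: energy_add_left energy_subdivide_interpolate[OF S] energy_subdivide_tent[OF S x])
qed

text \<open>By superposition \<open>K x - K y\<close> is a potential of a unit current from
  \<open>x\<close> to \<open>y\<close>. The subdivision varies with \<open>x\<close> and
  \<open>y\<close> while \<open>K\<close> does not, so one formula serves all points.\<close>

lemma resistance_eq_kernel:
  assumes "x \<in> points G L" "y \<in> points G L"
  shows "resistance G L x y = K x x + K y y - 2 * K y x"
proof -
  have S: "{x, y} \<subseteq> points G L" "finite {x, y}" using assms by auto
  have "energy (subdivide G L {x, y}) segment_length (\<lambda>v. K x v - K y v) g = g x - g y" for g
    by (simp add: energy_diff_left energy_kernel[OF S])
  then have "resistance G L x y = (K x x - K y x) - (K x y - K y y)"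
    unfolding resistance_def
    using fin_digraph_subdivide[OF S] by (intro vertex_resistance_eqI) (auto simp: verts_subdivide)
  then show ?thesis using kernel_commute[OF assms] by simp
qed

text \<open>The only kink of \<open>K y\<close> inside an edge is at \<open>y\<close>, which is a
  cut.\<close>

lemma kernel_affine:
  assumes y: "y \<in> points G L" and e: "e \<in> arcs G"
    and ab: "(a, b) \<in> consecutive (cuts L {y} e)"
  obtains A \<kappa> where "\<And>t. t \<in> {a..b} \<Longrightarrow> K y (edge_point G L e t) = A + \<kappa> * t"
proof -
  have "a \<in> cuts L {y} e" "b \<in> cuts L {y} e" "a < b" using ab by (auto simp: consecutive_def)
  then have bd: "0 \<le> a" "a < b" "b \<le> L e" using cuts_bounds[OF _ e, of "{y}"] y by auto
  define F where "F v = interpolate G L (\<lambda>u. j u v) y" for v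
  define A B where "A = F (tail G e)" and "B = (F (head G e) - F (tail G e)) / L e"
  have AB: "K y (edge_point G L e t) = A + t * B + tent L y (edge_point G L e t)" for t
    by (simp add: kernel_conv_interpolate interpolate_edge_point[OF e] A_def B_def F_def)
  show ?thesis
  proof (cases "\<exists>t\<^sub>0. y = Inner e t\<^sub>0")
    case False
    then have "tent L y (edge_point G L e t) = 0" for t
      by (auto simp: tent_def edge_point_def split: point.split)
    then show ?thesis using that[of A B] AB by (simp add: mult.commute)
  next
    case True
    then obtain t\<^sub>0 where t0: "y = Inner e t\<^sub>0" by blast
    then have "t\<^sub>0 \<in> cuts L {y} e" by (simp add: cuts_def)
    then consider "b \<le> t\<^sub>0" | "t\<^sub>0 \<le> a" using consecutive_not_between[OF ab] by blast
    then show ?thesis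
    proof cases
      case 1
      have "tent L y (edge_point G L e t) = t * (1 - t\<^sub>0 / L e)" if "t \<in> {a..b}" for t
        using that bd y 1 by (auto simp: t0 tent_edge_point[OF e])
      then show ?thesis
        using that[of A "B + (1 - t\<^sub>0 / L e)"] by (simp add: AB algebra_simps)
    next
      case 2
      have "tent L y (edge_point G L e t) = t\<^sub>0 * (1 - t / L e)" if "t \<in> {a..b}" for t
        using that bd y 2 by (cases "t = t\<^sub>0") (auto simp: t0 tent_edge_point[OF e])
      then show ?thesis
        using that[of "A + t\<^sub>0" "B - t\<^sub>0 / L e"] by (simp add: AB algebra_simps)
    qed
  qed
qed

text \<open>Interpolating \<open>j\<close> in both arguments gives the quadratic coefficient
  \<open>edge_resistance e / (L e)\<^sup>2\<close>; the diagonal \<open>t * (1 - t / L e)\<close> of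
  the tent supplies the rest.\<close>

lemma kernel_diagonal:
  assumes "e \<in> arcs G" "0 \<le> t" "t \<le> L e"
  shows "K (edge_point G L e t) (edge_point G L e t) =
    j (tail G e) (tail G e)
    + (j (head G e) (head G e) - j (tail G e) (tail G e) + (L e - edge_resistance e)) / L e * t
    + - (L e - edge_resistance e) / (L e)\<^sup>2 * t\<^sup>2"
proof -
  have "tent L (edge_point G L e t) (edge_point G L e t) = t * (1 - t / L e)"
    using length_pos[OF assms(1)] by (auto simp: tent_def edge_point_def divide_simps)
  moreover have "j (head G e) (tail G e) = j (tail G e) (head G e)"
    using assms by (intro green_commute[OF green]) auto
  ultimately show ?thesis
    using length_pos[OF assms(1)]
    by (simp add: kernel_def interpolate_edge_point[OF assms(1)] edge_resistance_def)
      (simp add: field_simps power2_eq_square)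
qed

lemma tau_at_eq:
  assumes y: "y \<in> points G L"
  shows "tau_at G L y = 1 / 4 * (\<Sum>e\<in>arcs G.
    (j (head G e) (head G e) - j (tail G e) (tail G e))\<^sup>2 / L e + (L e - edge_resistance e)\<^sup>2 / (3 * L e))"
proof -
  have S: "{y} \<subseteq> points G L" "finite {y}" using y by auto
  let ?p = "edge_point G L"
  have int: "integral {0..L e} (\<lambda>t. (deriv (\<lambda>s. resistance G L (?p e s) y) t)\<^sup>2) =
      ((j (head G e) (head G e) - j (tail G e) (tail G e))\<^sup>2 / L e + (L e - edge_resistance e)\<^sup>2 / (3 * L e))
      - 4 * (\<Sum>(a, b)\<in>consecutive (cuts L {y} e).
          (K y (?p e b) - K y (?p e a)) *
          ((K (?p e b) (?p e b) - K y (?p e b)) - (K (?p e a) (?p e a) - K y (?p e a))) / (b - a))"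
    (is "_ = ?T - 4 * ?E") if e: "e \<in> arcs G" for e
  proof -
    define \<alpha> where "\<alpha> = j (tail G e) (tail G e)"
    define \<beta> where "\<beta> = (j (head G e) (head G e) - j (tail G e) (tail G e) + (L e - edge_resistance e)) / L e"
    define \<gamma> where "\<gamma> = - (L e - edge_resistance e) / (L e)\<^sup>2"
    define H where "H s = \<beta>\<^sup>2 * s + 2 * \<beta> * \<gamma> * s\<^sup>2 + 4 / 3 * \<gamma>\<^sup>2 * s ^ 3" for s
    have diag: "K (?p e t) (?p e t) = \<alpha> + \<beta> * t + \<gamma> * t\<^sup>2" if "0 \<le> t" "t \<le> L e" for t
      unfolding \<alpha>_def \<beta>_def \<gamma>_def using that e by (intro kernel_diagonal)
    \<comment> \<open>The slope \<kappa> is expressed by the increment of \<open>K y\<close> over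
      the segment length, which gives the cross term the shape of a summand of the energy.\<close>
    define I where "I a b = (H b - H a) - 4 * ((K y (?p e b) - K y (?p e a)) *
          ((K (?p e b) (?p e b) - K y (?p e b)) - (K (?p e a) (?p e a) - K y (?p e a))) / (b - a))" for a b
    have "((\<lambda>t. (deriv (\<lambda>s. resistance G L (?p e s) y) t)\<^sup>2) has_integral I a b) {a..b}"
      if ab: "(a, b) \<in> consecutive (cuts L {y} e)" for a b
    proof -
      have "a \<in> cuts L {y} e" "b \<in> cuts L {y} e" "a < b" using ab by (auto simp: consecutive_def)
      then have bd: "0 \<le> a" "a < b" "b \<le> L e" using cuts_bounds[OF S(1) e] by auto
      obtain A \<kappa> where aff: "\<And>t. t \<in> {a..b} \<Longrightarrow> K y (?p e t) = A + \<kappa> * t"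
        using kernel_affine[OF y e ab] by blast
      have "resistance G L (?p e s) y = (\<alpha> + K y y - 2 * A) + \<beta> * s + \<gamma> * s\<^sup>2 - 2 * \<kappa> * s"
        if "s \<in> {a<..<b}" for s
        using that bd e y aff[of s] by (simp add: resistance_eq_kernel edge_point_in_points diag)
      from has_integral_deriv_square_quadratic[OF bd(2) this]
      have "((\<lambda>t. (deriv (\<lambda>s. resistance G L (?p e s) y) t)\<^sup>2) has_integral
         (H b - H a) - 4 * \<kappa> * ((\<beta> * b + \<gamma> * b\<^sup>2) - (\<beta> * a + \<gamma> * a\<^sup>2) - \<kappa> * (b - a))) {a..b}"
        by (simp add: H_def)
      also have "(H b - H a) - 4 * \<kappa> * ((\<beta> * b + \<gamma> * b\<^sup>2) - (\<beta> * a + \<gamma> * a\<^sup>2) - \<kappa> * (b - a)) = I a b"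
      proof -
        have "K y (?p e b) - K y (?p e a) = \<kappa> * (b - a)"
          using bd by (simp add: aff algebra_simps)
        moreover have "(K (?p e b) (?p e b) - K y (?p e b)) - (K (?p e a) (?p e a) - K y (?p e a))
           = (\<beta> * b + \<gamma> * b\<^sup>2) - (\<beta> * a + \<gamma> * a\<^sup>2) - \<kappa> * (b - a)"
          using bd by (simp add: aff diag algebra_simps)
        ultimately show ?thesis using bd by (simp add: I_def)
      qed
      finally show ?thesis .
    qed
    from has_integral_consecutive[OF finite_cuts[OF S(2), of e] cuts_nonempty this]
    have "((\<lambda>t. (deriv (\<lambda>s. resistance G L (?p e s) y) t)\<^sup>2) has_integral
        (\<Sum>(a, b)\<in>consecutive (cuts L {y} e). I a b)) {0..L e}"
      by (simp add: Min_cuts[OF S e] Max_cuts[OF S e])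
    then have "integral {0..L e} (\<lambda>t. (deriv (\<lambda>s. resistance G L (?p e s) y) t)\<^sup>2)
        = (\<Sum>(a, b)\<in>consecutive (cuts L {y} e). I a b)"
      by (rule integral_unique)
    also have "\<dots> = (\<Sum>(a, b)\<in>consecutive (cuts L {y} e). H b - H a) - 4 * ?E"
      by (simp add: I_def case_prod_unfold sum_subtractf sum_distrib_left)
    also have "(\<Sum>(a, b)\<in>consecutive (cuts L {y} e). H b - H a) = H (L e) - H 0"
      by (rule sum_cuts[OF S e])
    \<comment> \<open>For d the increment of the diagonal of \<open>j\<close> and u =
      \<open>L e - edge_resistance e\<close>, the value is ((d + u)^2 - 2 (d + u) u + 4 u^2 / 3) /
      \<open>L e\<close>, in which the mixed terms cancel.\<close>
    also have "\<dots> = ?T"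
      using length_pos[OF e] unfolding H_def \<beta>_def \<gamma>_def
      by (simp add: field_simps power2_eq_square power3_eq_cube)
    finally show ?thesis .
  qed
  have "(\<Sum>e\<in>arcs G. \<Sum>(a, b)\<in>consecutive (cuts L {y} e).
          (K y (?p e b) - K y (?p e a)) *
          ((K (?p e b) (?p e b) - K y (?p e b)) - (K (?p e a) (?p e a) - K y (?p e a))) / (b - a))
      = energy (subdivide G L {y}) segment_length (K y) (\<lambda>x. K x x - K y x)"
    by (simp add: energy_subdivide)
  \<comment> \<open>The energy is the value of \<open>K x x - K y x\<close> at \<open>y\<close>
    minus its value at the ground, and both are 0.\<close>
  also have "\<dots> = 0"
    using energy_kernel[OF S, of y] ground_in_verts kernel_ground[OF y] kernel_ground[of "Vertex z"]
    by (simp add: points_def)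
  finally show ?thesis
    unfolding tau_at_def using int by (simp add: sum_subtractf sum_distrib_left[symmetric])
qed

lemma tau_eq:
  "tau G L = 1 / 4 * (\<Sum>e\<in>arcs G.
    (j (head G e) (head G e) - j (tail G e) (tail G e))\<^sup>2 / L e + (L e - edge_resistance e)\<^sup>2 / (3 * L e))"
  unfolding tau_def
proof (rule the_equality)
  show "\<forall>y\<in>points G L. tau_at G L y = 1 / 4 * (\<Sum>e\<in>arcs G.
    (j (head G e) (head G e) - j (tail G e) (tail G e))\<^sup>2 / L e + (L e - edge_resistance e)\<^sup>2 / (3 * L e))"
    using tau_at_eq by blast
next
  fix c assume "\<forall>y\<in>points G L. tau_at G L y = c"
  \<comment> \<open>Uniqueness of the common value rests on the existence of some base
    point.\<close>
  moreover have z: "Vertex z \<in> points G L" using ground_in_verts by (simp add: points_def)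
  ultimately show "c = 1 / 4 * (\<Sum>e\<in>arcs G.
    (j (head G e) (head G e) - j (tail G e) (tail G e))\<^sup>2 / L e + (L e - edge_resistance e)\<^sup>2 / (3 * L e))"
    using tau_at_eq[OF z] by simp
qed

section \<open>Edge resistances from arbitrary potentials\<close>

lemma edge_potential:
  assumes "e \<in> arcs G"
  shows "\<exists>f. (\<forall>g. energy G L f g = g (tail G e) - g (head G e))
    \<and> edge_resistance e = f (tail G e) - f (head G e)"
  using green assms green_commute[OF green, of "tail G e" "head G e"]
  by (intro exI[of _ "\<lambda>v. j (tail G e) v - j (head G e) v"])
    (simp add: energy_diff_left green_def edge_resistance_def)

text \<open>Symmetry of the energy again equates the drops of two potentials, so one built from the
  graph without \<open>e\<close> may be used.\<close>

lemma edge_resistance_unique: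
  assumes "e \<in> arcs G" "\<And>g. energy G L f g = g (tail G e) - g (head G e)"
  shows "edge_resistance e = f (tail G e) - f (head G e)"
  using edge_potential[OF assms(1)] assms(2) by (metis energy_commute)

end

subsection \<open>Deleting and multiplying edges\<close>

text \<open>The edge is in parallel with the rest of the graph, so r = L R / (L + R) and L - r = L^2
  / (L + R). For a bridge all current passes through the edge, hence r = L and both sides are
  0.\<close>

lemma (in grounded_network) complementary_term_eq:
  assumes con: "Digraph_Component.connected G" and e: "e \<in> arcs G"
  shows "real_of_ereal (ereal ((L e)\<^sup>2) / (ereal (L e) + complementary_resistance G L e))
    = L e - edge_resistance e"
proof -
  let ?p = "tail G e" and ?q = "head G e"
  let ?G' = "del_arc e"
  interpret G': fin_digraph ?G' by (rule fin_digraph_del_arc)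
  interpret G': resistor_network ?G' L
    by unfold_locales (simp add: length_pos)
  have arcs: "arcs G = insert e (arcs ?G')" "e \<notin> arcs ?G'" using e by auto
  have energy: "energy G L f g = energy ?G' L f g + (f ?q - f ?p) * (g ?q - g ?p) / L e" for f g
    unfolding energy_def arcs(1) by (subst sum.insert) (use arcs in auto)
  have Le: "0 < L e" by (rule length_pos[OF e])
  show ?thesis
  proof (cases "Digraph_Component.connected ?G'")
    case True
    then have "metrized_graph ?G' L"
      using G'.fin_digraph_axioms G'.length_pos by (simp add: metrized_graph_def)
    then obtain j' where j': "green ?G' L z j'"
      using green_exists[of ?G' L z] ground_in_verts by auto
    interpret G': grounded_network ?G' L z j' by unfold_locales (rule j')
    define f where "f v = j' ?p v - j' ?q v" for v
    have pq: "?p \<in> verts ?G'" "?q \<in> verts ?G'" using e by auto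
    then have f: "energy ?G' L f g = g ?p - g ?q" for g
      using j' unfolding f_def by (simp add: energy_diff_left green_def)
    define R where "R = f ?p - f ?q"
    have "resistance ?G' L (Vertex ?p) (Vertex ?q) = R"
      using pq green_commute[OF j' pq]
      by (simp add: G'.resistance_eq_kernel points_def kernel_def R_def f_def)
    then have cr: "complementary_resistance G L e = ereal R"
      using True by (simp add: complementary_resistance_def)
    \<comment> \<open>\<open>R\<close> is the energy of \<open>f\<close> with itself; hence
      \<open>L e + R\<close> is positive.\<close>
    have R: "0 \<le> R" using energy_nonneg[of ?G' L f] G'.length_pos by (simp add: f R_def)
    \<comment> \<open>Current division: putting \<open>e\<close> back sends an extra current
      \<open>R / L e\<close> through it, so \<open>f\<close> is rescaled from total current
      \<open>1 + R / L e\<close> to 1.\<close>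
    have "energy G L (\<lambda>v. L e / (L e + R) * f v) g = g ?p - g ?q" for g
    proof -
      have "energy G L f g = (1 + R / L e) * (g ?p - g ?q)"
        using Le by (simp add: energy f R_def divide_simps algebra_simps)
      then show ?thesis unfolding energy_scale_left using Le R by (simp add: divide_simps mult_ac)
    qed
    from edge_resistance_unique[OF e this]
    have "edge_resistance e = L e / (L e + R) * R" by (simp add: R_def right_diff_distrib)
    then show ?thesis using Le R by (simp add: cr divide_simps power2_eq_square algebra_simps)
  next
    case False
    then obtain h :: "'v \<Rightarrow> real" and u v where h: "\<forall>e\<in>arcs ?G'. h (head ?G' e) = h (tail ?G' e)"
      and uv: "u \<in> verts G" "v \<in> verts G" "h u \<noteq> h v"
      using ground_in_verts by (auto simp: connected_iff_invariant_constant[OF G'.wf_digraph])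
    have "h ?q \<noteq> h ?p"
    proof
      assume "h ?q = h ?p"
      then have "\<forall>e\<in>arcs G. h (head G e) = h (tail G e)" using h unfolding arcs(1) by auto
      with con uv show False by (auto simp: connected_iff_invariant_constant[OF wf_digraph])
    qed
    moreover obtain f where f: "\<And>g. energy G L f g = g ?p - g ?q" "edge_resistance e = f ?p - f ?q"
      using edge_potential[OF e] by blast
    \<comment> \<open>Tested against \<open>h\<close>, which is constant along all other arcs, the
      equation for \<open>f\<close> only sees \<open>e\<close> and fixes the drop of
      \<open>f\<close> along it.\<close>
    moreover have "energy ?G' L f h = 0" using h by (simp add: energy_def)
    ultimately have "(f ?q - f ?p) * (h ?q - h ?p) = L e * (h ?p - h ?q)"
      using energy[of f h] f(1)[of h] Le by (simp add: field_simps)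
    then have "(h ?q - h ?p) * (f ?q - f ?p + L e) = 0" by (simp add: algebra_simps)
    then have "edge_resistance e = L e" using \<open>h ?q \<noteq> h ?p\<close> f(2) by simp
    \<comment> \<open>A finite number divided by \<infinity> is 0 in \<open>ereal\<close>.\<close>
    then show ?thesis using False by (simp add: complementary_resistance_def)
  qed
qed

section \<open>Passing to multiplied edges\<close>

lemma energy_multiply_edges:
  "energy (multiply_edges G n) (multiply_edges_length L n) f g = (real n)\<^sup>2 * energy G L f g"
  by (simp add: energy_def multiply_edges_def multiply_edges_length_def sum.cartesian_product'
      sum_distrib_left power2_eq_square mult_ac)

text \<open>An edge becomes \<open>n\<close> copies, each of conductance \<open>n\<close> times the
  old one. The energy gains the factor \<open>n^2\<close>, which the division of \<open>j\<close>
  compensates.\<close>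

lemma grounded_network_multiply_edges:
  assumes "grounded_network G L z j" "0 < n"
  shows "grounded_network (multiply_edges G n) (multiply_edges_length L n) z (\<lambda>u v. j u v / (real n)\<^sup>2)"
proof -
  interpret grounded_network G L z j by fact
  have "energy G L (\<lambda>v. j u v / (real n)\<^sup>2) g = energy G L (j u) g / (real n)\<^sup>2" for u g
    using energy_scale_left[of G L "1 / (real n)\<^sup>2" "j u" g] by simp
  then have "green (multiply_edges G n) (multiply_edges_length L n) z (\<lambda>u v. j u v / (real n)\<^sup>2)"
    using green assms(2) by (simp add: green_def energy_multiply_edges) (simp add: multiply_edges_def)
  then show ?thesis
    using assms(2) length_pos
    by unfold_locales (auto simp: multiply_edges_def multiply_edges_length_def)
qed

theorem theorem3p4:
  fixes G :: "('v, 'e) pre_digraph" and L :: "'e \<Rightarrow> real" and n :: nat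
  assumes "metrized_graph G L" and "n \<ge> 2"
  shows "tau (multiply_edges G n) (multiply_edges_length L n) =
    tau G L / (real n)\<^sup>2
    + total_length G L / 12 * ((real n - 1) / real n)\<^sup>2
    + (real n - 1) / (6 * (real n)\<^sup>2) *
        (\<Sum>e\<in>arcs G. real_of_ereal
           (ereal ((L e)\<^sup>2) / (ereal (L e) + complementary_resistance G L e)))"
proof -
  have con: "Digraph_Component.connected G" using assms(1) by (simp add: metrized_graph_def)
  interpret fin_digraph G using assms(1) by (simp add: metrized_graph_def)
  obtain z where z: "z \<in> verts G" using con by (auto simp: connected_iff_invariant_constant[OF wf_digraph])
  obtain j where j: "green G L z j" using green_exists[OF assms(1) z] by blast
  interpret grounded_network G L z j
    using assms(1) j by unfold_locales (auto simp: metrized_graph_def)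
  let ?N = "real n"
  have N: "?N > 0" using assms(2) by simp
  interpret M: grounded_network "multiply_edges G n" "multiply_edges_length L n" z "\<lambda>u v. j u v / ?N\<^sup>2"
    using assms(2) by (intro grounded_network_multiply_edges grounded_network_axioms) simp
  have r: "M.edge_resistance (e, k) = edge_resistance e / ?N\<^sup>2" for e k
    unfolding M.edge_resistance_def edge_resistance_def
    by (simp add: multiply_edges_def add_divide_distrib diff_divide_distrib)
  define D where "D e = (j (head G e) (head G e) - j (tail G e) (tail G e))\<^sup>2" for e
  have D: "(j (head G e) (head G e) / ?N\<^sup>2 - j (tail G e) (tail G e) / ?N\<^sup>2)\<^sup>2 = D e / ?N ^ 4" for e
    using N by (simp add: D_def diff_divide_distrib[symmetric] power_divide flip: power_mult)
  have "tau (multiply_edges G n) (multiply_edges_length L n) =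
     1 / 4 * (\<Sum>e\<in>arcs G. ?N * (D e / ?N ^ 4 / (L e / ?N)
        + (L e / ?N - edge_resistance e / ?N\<^sup>2)\<^sup>2 / (3 * (L e / ?N))))"
  proof -
    have "arcs (multiply_edges G n) = arcs G \<times> {..<n}"
      and "tail (multiply_edges G n) (e, k) = tail G e"
      and "head (multiply_edges G n) (e, k) = head G e" for e k
      by (simp_all add: multiply_edges_def)
    then show ?thesis
      unfolding M.tau_eq by (simp add: sum.cartesian_product' r multiply_edges_length_def D)
  qed
  \<comment> \<open>With u = \<open>L e - edge_resistance e\<close>, the resistance term on the left
    is ((N - 1) L + u)^2 / (3 L N^2), where N is \<open>?N\<close> and L is \<open>L e\<close>. Its
    u^2, L^2 and mixed parts go to the three terms on the right.\<close>
  also have "\<dots> = (\<Sum>e\<in>arcs G. 1 / 4 * (D e / L e + (L e - edge_resistance e)\<^sup>2 / (3 * L e)) / ?N\<^sup>2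
      + L e / 12 * ((?N - 1) / ?N)\<^sup>2 + (?N - 1) / (6 * ?N\<^sup>2) * (L e - edge_resistance e))"
    unfolding sum_distrib_left
  proof (rule sum.cong[OF refl])
    fix e assume "e \<in> arcs G"
    then have "L e \<noteq> 0" by (rule length_nonzero)
    then show "1 / 4 * (?N * (D e / ?N ^ 4 / (L e / ?N)
        + (L e / ?N - edge_resistance e / ?N\<^sup>2)\<^sup>2 / (3 * (L e / ?N)))) =
      1 / 4 * (D e / L e + (L e - edge_resistance e)\<^sup>2 / (3 * L e)) / ?N\<^sup>2
      + L e / 12 * ((?N - 1) / ?N)\<^sup>2 + (?N - 1) / (6 * ?N\<^sup>2) * (L e - edge_resistance e)"
      using N by (simp add: field_simps power2_eq_square power4_eq_xxxx)
  qed
  also have "\<dots> = tau G L / ?N\<^sup>2 + total_length G L / 12 * ((?N - 1) / ?N)\<^sup>2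
      + (?N - 1) / (6 * ?N\<^sup>2) * (\<Sum>e\<in>arcs G. L e - edge_resistance e)"
    unfolding tau_eq total_length_def D_def
    by (simp add: sum.distrib sum_distrib_left sum_distrib_right sum_divide_distrib
        add_divide_distrib)
  finally show ?thesis by (simp add: complementary_term_eq[OF con])
qed

end
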